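(* Let $R$ be a commutative ring with unity having countably infinitely many maximal ideals, and let $M$ be an $R$-module with $\operatorname{Spec}(M)\neq\emptyset$. (i) If $M$ is a finitely generated faithful $R$-module, then $\widetilde{\operatorname{Spec}(M)}$ is a Lindelöf space which is not quasi-compact. (ii) If $M$ is a free $R$-module of finite rank, then $\widetilde{\operatorname{Spec}(M)}$ is a Lindelöf space which is not quasi-compact.
   Context: For a submodule $N$ of an $R$-module $M$, $(N:M)=\{r\in R : rM\subseteq N\}$. A proper submodule $P$ of $M$ is prime if whenever $rm\in P$ with $r\in R$, $m\in M$, then $m\in P$ or $r\in(P:M)$; in this case $(P:M)$ is a prime ideal of $R$. $\operatorname{Spec}(M)$ is the set of all prime submodules of $M$. A subset $T\subseteq R$ is multiplicatively closed if $1\in T$ and $xy\in T$ whenever $x,y\in T$. For a family $\mathcal{S}=\{S_i\}_{i\in I}$ of multiplicatively closed subsets of $R$, $\widetilde{V}(\mathcal{S})=\{P\in\operatorname{Spec}(M) \mid (P:M)\cap S_i\neq\emptyset \text{ for all } i\in I\}$. $\widetilde{\operatorname{Spec}(M)}$ denotes the set $\operatorname{Spec}(M)$ with the topology whose closed sets are exactly the sets $\widetilde{V}(\mathcal{S})$, $\mathcal{S}$ ranging over all families of multiplicatively closed subsets of $R$. A topological space is Lindelöf if every open cover has a countable subcover, and quasi-compact if every open cover has a finite subcover. *)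

theory Defs
  imports "HOL-Analysis.Lindelof_Spaces" "HOL-Algebra.Ideal" "HOL-Algebra.Module"
begin

text \<open>
  The name \<open>module\<close> is used both by \<open>HOL.Modules\<close> (type classes) and by \<open>HOL-Algebra.Module\<close>
  (explicit carriers). The qualified name \<open>Module.module\<close> refers to the latter; it includes that
  the scalars form a commutative ring with unity.
\<close>

definition module_colon ::
  "('a, 'c) ring_scheme \<Rightarrow> ('a, 'b, 'd) module_scheme \<Rightarrow> 'b set \<Rightarrow> 'a set" where
  "module_colon R M N = {r \<in> carrier R. \<forall>m \<in> carrier M. r \<odot>\<^bsub>M\<^esub> m \<in> N}"

definition prime_submodule ::
  "('a, 'c) ring_scheme \<Rightarrow> ('a, 'b, 'd) module_scheme \<Rightarrow> 'b set \<Rightarrow> bool" where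
  "prime_submodule R M P \<longleftrightarrow>
     submodule P R M \<and> P \<noteq> carrier M \<and>
     (\<forall>r \<in> carrier R. \<forall>m \<in> carrier M. r \<odot>\<^bsub>M\<^esub> m \<in> P \<longrightarrow> m \<in> P \<or> r \<in> module_colon R M P)"

definition mod_Spec ::
  "('a, 'c) ring_scheme \<Rightarrow> ('a, 'b, 'd) module_scheme \<Rightarrow> 'b set set" where
  "mod_Spec R M = {P. prime_submodule R M P}"

definition V_tilde ::
  "('a, 'c) ring_scheme \<Rightarrow> ('a, 'b, 'd) module_scheme \<Rightarrow> 'a set set \<Rightarrow> 'b set set" where
  "V_tilde R M \<S> = {P \<in> mod_Spec R M. \<forall>S \<in> \<S>. module_colon R M P \<inter> S \<noteq> {}}"

text \<open>
  A multiplicatively closed subset of \<open>R\<close> is a \<open>submonoid\<close> of the (multiplicative) monoid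
  underlying \<open>R\<close>. Since \<open>V_tilde\<close> does not depend on how a family is indexed, families are
  represented by sets of subsets. A topology is given by its open sets, hence the complements;
  lemma \<open>closedin_Spec_tilde\<close> below recovers the description by closed sets.
\<close>

definition Spec_tilde ::
  "('a, 'c) ring_scheme \<Rightarrow> ('a, 'b, 'd) module_scheme \<Rightarrow> 'b set topology" where
  "Spec_tilde R M = topology (\<lambda>U. \<exists>\<S>. (\<forall>S \<in> \<S>. submonoid S R) \<and> U = mod_Spec R M - V_tilde R M \<S>)"

definition faithful_module ::
  "('a, 'c) ring_scheme \<Rightarrow> ('a, 'b, 'd) module_scheme \<Rightarrow> bool" where
  "faithful_module R M \<longleftrightarrow>
     (\<forall>r \<in> carrier R. (\<forall>m \<in> carrier M. r \<odot>\<^bsub>M\<^esub> m = \<zero>\<^bsub>M\<^esub>) \<longrightarrow> r = \<zero>\<^bsub>R\<^esub>)"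

definition finite_generating_set ::
  "('a, 'c) ring_scheme \<Rightarrow> ('a, 'b, 'd) module_scheme \<Rightarrow> 'b set \<Rightarrow> bool" where
  "finite_generating_set R M X \<longleftrightarrow>
     finite X \<and> X \<subseteq> carrier M \<and>
     (\<forall>m \<in> carrier M. \<exists>c \<in> X \<rightarrow> carrier R. m = (\<Oplus>\<^bsub>M\<^esub>x\<in>X. c x \<odot>\<^bsub>M\<^esub> x))"

definition fin_gen_module ::
  "('a, 'c) ring_scheme \<Rightarrow> ('a, 'b, 'd) module_scheme \<Rightarrow> bool" where
  "fin_gen_module R M \<longleftrightarrow> (\<exists>X. finite_generating_set R M X)"

definition finite_basis ::
  "('a, 'c) ring_scheme \<Rightarrow> ('a, 'b, 'd) module_scheme \<Rightarrow> 'b set \<Rightarrow> bool" where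
  "finite_basis R M B \<longleftrightarrow>
     finite_generating_set R M B \<and>
     (\<forall>c \<in> B \<rightarrow> carrier R. (\<Oplus>\<^bsub>M\<^esub>x\<in>B. c x \<odot>\<^bsub>M\<^esub> x) = \<zero>\<^bsub>M\<^esub> \<longrightarrow> (\<forall>x \<in> B. c x = \<zero>\<^bsub>R\<^esub>))"

definition free_module_fin_rank ::
  "('a, 'c) ring_scheme \<Rightarrow> ('a, 'b, 'd) module_scheme \<Rightarrow> bool" where
  "free_module_fin_rank R M \<longleftrightarrow> (\<exists>B. finite_basis R M B)"

lemma prime_submodule_colon_mult:
  assumes "Module.module R M" "prime_submodule R M P" "a \<in> carrier R" "b \<in> carrier R"
    "a \<otimes>\<^bsub>R\<^esub> b \<in> module_colon R M P"
  shows "a \<in> module_colon R M P \<or> b \<in> module_colon R M P"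
proof -
  interpret Module.module R M by fact
  show ?thesis
    using assms(2-5) unfolding prime_submodule_def module_colon_def
    by (auto simp: smult_assoc1)
qed

lemma module_colon_mult:
  assumes "Module.module R M" "prime_submodule R M P" "a \<in> carrier R" "b \<in> carrier R"
    "a \<in> module_colon R M P \<or> b \<in> module_colon R M P"
  shows "a \<otimes>\<^bsub>R\<^esub> b \<in> module_colon R M P"
proof -
  interpret Module.module R M by fact
  have *: "x \<otimes>\<^bsub>R\<^esub> y \<in> module_colon R M P"
    if "x \<in> carrier R" "y \<in> carrier R" "x \<in> module_colon R M P" for x y
    using that unfolding module_colon_def by (auto simp: smult_assoc1)
  show ?thesis
    using *[of a b] *[of b a] assms(3-5) R.m_comm[of a b] by auto
qed

lemma one_notin_module_colon:
  assumes "Module.module R M" "prime_submodule R M P"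
  shows "\<one>\<^bsub>R\<^esub> \<notin> module_colon R M P"
proof -
  interpret Module.module R M by fact
  have "P \<subseteq> carrier M" "P \<noteq> carrier M"
    using assms(2) submoduleE(1) by (auto simp: prime_submodule_def)
  then show ?thesis by (auto simp: module_colon_def)
qed

lemma submonoid_set_mult:
  assumes "cring R" "submonoid S R" "submonoid T R"
  shows "submonoid (S <#>\<^bsub>R\<^esub> T) R"
proof -
  interpret cring R by fact
  interpret S: submonoid S R by fact
  interpret T: submonoid T R by fact
  have mem: "z \<in> S <#>\<^bsub>R\<^esub> T \<longleftrightarrow> (\<exists>s\<in>S. \<exists>t\<in>T. z = s \<otimes>\<^bsub>R\<^esub> t)" for z
    by (simp add: set_mult_def)
  show ?thesis
  proof (rule submonoid.intro)
    show "S <#>\<^bsub>R\<^esub> T \<subseteq> carrier R"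
      using set_mult_closed[OF S.subset T.subset] .
    show "\<one>\<^bsub>R\<^esub> \<in> S <#>\<^bsub>R\<^esub> T"
      unfolding mem by (rule bexI[OF bexI[OF _ T.one_closed] S.one_closed]) simp
  next
    fix x y assume "x \<in> S <#>\<^bsub>R\<^esub> T" "y \<in> S <#>\<^bsub>R\<^esub> T"
    then obtain s t s' t' where *: "s \<in> S" "t \<in> T" "s' \<in> S" "t' \<in> T"
      and xy: "x = s \<otimes>\<^bsub>R\<^esub> t" "y = s' \<otimes>\<^bsub>R\<^esub> t'"
      unfolding mem by blast
    have "x \<otimes>\<^bsub>R\<^esub> y = (s \<otimes>\<^bsub>R\<^esub> s') \<otimes>\<^bsub>R\<^esub> (t \<otimes>\<^bsub>R\<^esub> t')"
      unfolding xy
      by (simp add: m_ac S.mem_carrier T.mem_carrier *)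
    then show "x \<otimes>\<^bsub>R\<^esub> y \<in> S <#>\<^bsub>R\<^esub> T"
      unfolding mem by (intro bexI[OF bexI[OF _ T.m_closed[OF *(2,4)]] S.m_closed[OF *(1,3)]])
  qed
qed

lemma colon_Int_set_mult_iff:
  assumes "Module.module R M" "P \<in> mod_Spec R M" "submonoid S R" "submonoid T R"
  shows "module_colon R M P \<inter> (S <#>\<^bsub>R\<^esub> T) \<noteq> {} \<longleftrightarrow>
         module_colon R M P \<inter> S \<noteq> {} \<or> module_colon R M P \<inter> T \<noteq> {}"
proof -
  interpret Module.module R M by fact
  interpret S: submonoid S R by fact
  interpret T: submonoid T R by fact
  have P: "prime_submodule R M P" using assms(2) by (simp add: mod_Spec_def)
  have *: "s \<otimes>\<^bsub>R\<^esub> t \<in> module_colon R M P \<longleftrightarrow> s \<in> module_colon R M P \<or> t \<in> module_colon R M P"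
    if "s \<in> S" "t \<in> T" for s t
  proof -
    have st: "s \<in> carrier R" "t \<in> carrier R"
      using that S.subset T.subset by blast+
    show ?thesis
      using prime_submodule_colon_mult[OF assms(1) P st] module_colon_mult[OF assms(1) P st]
      by (rule iffI)
  qed
  have "module_colon R M P \<inter> (S <#>\<^bsub>R\<^esub> T) \<noteq> {} \<longleftrightarrow>
        (\<exists>s\<in>S. \<exists>t\<in>T. s \<otimes>\<^bsub>R\<^esub> t \<in> module_colon R M P)"
    unfolding set_mult_def by auto
  then show ?thesis using * S.one_closed T.one_closed by blast
qed

lemma istopology_Spec_tilde:
  assumes "Module.module R M"
  shows "istopology (\<lambda>U. \<exists>\<S>. (\<forall>S \<in> \<S>. submonoid S R) \<and> U = mod_Spec R M - V_tilde R M \<S>)"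
  unfolding istopology_def
proof (intro conjI allI impI)
  fix U V
  assume "\<exists>\<S>. (\<forall>S \<in> \<S>. submonoid S R) \<and> U = mod_Spec R M - V_tilde R M \<S>"
    "\<exists>\<S>. (\<forall>S \<in> \<S>. submonoid S R) \<and> V = mod_Spec R M - V_tilde R M \<S>"
  then obtain \<S> \<T> where *: "\<And>S. S \<in> \<S> \<Longrightarrow> submonoid S R" "\<And>S. S \<in> \<T> \<Longrightarrow> submonoid S R"
    "U = mod_Spec R M - V_tilde R M \<S>" "V = mod_Spec R M - V_tilde R M \<T>" by blast
  let ?W = "{S <#>\<^bsub>R\<^esub> T | S T. S \<in> \<S> \<and> T \<in> \<T>}"
  have cr: "cring R" using assms by (rule Module.module.axioms)
  have "P \<in> V_tilde R M ?W \<longleftrightarrow> P \<in> V_tilde R M \<S> \<or> P \<in> V_tilde R M \<T>"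
    if P: "P \<in> mod_Spec R M" for P
  proof -
    have "P \<in> V_tilde R M ?W \<longleftrightarrow>
        (\<forall>S\<in>\<S>. \<forall>T\<in>\<T>. module_colon R M P \<inter> (S <#>\<^bsub>R\<^esub> T) \<noteq> {})"
      using P unfolding V_tilde_def by blast
    also have "\<dots> \<longleftrightarrow> (\<forall>S\<in>\<S>. \<forall>T\<in>\<T>. module_colon R M P \<inter> S \<noteq> {} \<or> module_colon R M P \<inter> T \<noteq> {})"
      using colon_Int_set_mult_iff[OF assms P] * by simp
    also have "\<dots> \<longleftrightarrow> P \<in> V_tilde R M \<S> \<or> P \<in> V_tilde R M \<T>"
      using P unfolding V_tilde_def by blast
    finally show ?thesis .
  qed
  then have "U \<inter> V = mod_Spec R M - V_tilde R M ?W" using * by blast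
  moreover have "\<forall>S \<in> ?W. submonoid S R"
    using submonoid_set_mult[OF cr] * by blast
  ultimately show "\<exists>\<S>. (\<forall>S \<in> \<S>. submonoid S R) \<and> U \<inter> V = mod_Spec R M - V_tilde R M \<S>"
    by blast
next
  fix \<K>
  assume "\<forall>K\<in>\<K>. \<exists>\<S>. (\<forall>S \<in> \<S>. submonoid S R) \<and> K = mod_Spec R M - V_tilde R M \<S>"
  then obtain F where F: "\<And>K. K \<in> \<K> \<Longrightarrow> (\<forall>S \<in> F K. submonoid S R)"
    "\<And>K. K \<in> \<K> \<Longrightarrow> K = mod_Spec R M - V_tilde R M (F K)" by metis
  have *: "P \<in> \<Union>\<K> \<longleftrightarrow> P \<in> mod_Spec R M - V_tilde R M (\<Union>(F ` \<K>))" for P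
  proof -
    have "P \<in> \<Union>\<K> \<longleftrightarrow> (\<exists>K\<in>\<K>. P \<in> mod_Spec R M - V_tilde R M (F K))"
      using F(2) by blast
    also have "\<dots> \<longleftrightarrow> P \<in> mod_Spec R M - V_tilde R M (\<Union>(F ` \<K>))"
      unfolding V_tilde_def by blast
    finally show ?thesis .
  qed
  have "\<Union>\<K> = mod_Spec R M - V_tilde R M (\<Union>(F ` \<K>))" using * by blast
  moreover have "\<forall>S \<in> \<Union>(F ` \<K>). submonoid S R" using F(1) by blast
  ultimately show "\<exists>\<S>. (\<forall>S \<in> \<S>. submonoid S R) \<and> \<Union>\<K> = mod_Spec R M - V_tilde R M \<S>"
    by blast
qed

lemma openin_Spec_tilde:
  assumes "Module.module R M"
  shows "openin (Spec_tilde R M) U \<longleftrightarrow>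
    (\<exists>\<S>. (\<forall>S \<in> \<S>. submonoid S R) \<and> U = mod_Spec R M - V_tilde R M \<S>)"
  unfolding Spec_tilde_def by (simp add: istopology_Spec_tilde[OF assms])

lemma topspace_Spec_tilde:
  assumes "Module.module R M"
  shows "topspace (Spec_tilde R M) = mod_Spec R M"
proof
  show "topspace (Spec_tilde R M) \<subseteq> mod_Spec R M"
    using openin_Spec_tilde[OF assms, of "topspace (Spec_tilde R M)"] by auto
  interpret Module.module R M by fact
  have "submonoid {\<one>\<^bsub>R\<^esub>} R" by (rule submonoid.intro) auto
  moreover have "V_tilde R M {{\<one>\<^bsub>R\<^esub>}} = {}"
    using one_notin_module_colon[OF assms] unfolding V_tilde_def mod_Spec_def by auto
  ultimately have "openin (Spec_tilde R M) (mod_Spec R M)"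
    unfolding openin_Spec_tilde[OF assms] by (intro exI[of _ "{{\<one>\<^bsub>R\<^esub>}}"]) auto
  then show "mod_Spec R M \<subseteq> topspace (Spec_tilde R M)" by (rule openin_subset)
qed

lemma closedin_Spec_tilde:
  assumes "Module.module R M"
  shows "closedin (Spec_tilde R M) C \<longleftrightarrow>
    (\<exists>\<S>. (\<forall>S \<in> \<S>. submonoid S R) \<and> C = V_tilde R M \<S>)"
proof -
  have sub: "V_tilde R M \<S> \<subseteq> mod_Spec R M" for \<S> by (auto simp: V_tilde_def)
  have "C \<subseteq> mod_Spec R M \<and> mod_Spec R M - C = mod_Spec R M - V_tilde R M \<S> \<longleftrightarrow>
        C = V_tilde R M \<S>" for \<S>
    using sub[of \<S>] by blast
  then show ?thesis
    unfolding closedin_def topspace_Spec_tilde[OF assms] openin_Spec_tilde[OF assms] by metis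
qed

end

theory Submission
  imports Defs "HOL-Algebra.Ring_Divisibility"
begin

text \<open>
  Every open set that contains \<open>P\<close> also contains all \<open>Q\<close> with
  \<open>(Q:M) \<subseteq> (P:M)\<close>, and for a prime ideal \<open>\<pp>\<close> the set of all \<open>Q\<close> with \<open>(Q:M) \<subseteq> \<pp>\<close> is open, because
  it is defined by the multiplicatively closed set \<open>R - \<pp>\<close>. If \<open>M\<close> is finitely generated and faithful,
  then \<open>\<mm>M \<noteq> M\<close> for every maximal ideal \<open>\<mm>\<close> by a form of Nakayama's lemma, and so \<open>\<mm>M\<close> is a prime
  submodule with \<open>(\<mm>M:M) = \<mm>\<close>. Members of an open cover that contain the countably many \<open>\<mm>M\<close>
  therefore cover everything. The sets \<open>{Q. (Q:M) \<subseteq> \<mm>}\<close> form an open cover in which \<open>\<mm>M\<close> lies only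
  in the member belonging to \<open>\<mm>\<close>, so there is no finite subcover.
\<close>

section \<open>Maximal ideals and the prime submodules lying over them\<close>

text \<open>Zorn's lemma for the ideals above \<open>I\<close> that avoid \<open>\<one>\<close>:
  unions of nonempty chains still avoid \<open>\<one>\<close>, and a maximal member is a maximal
  ideal because an ideal containing \<open>\<one>\<close> is the whole ring.\<close>

lemma (in cring) exists_maximalideal_superset:
  assumes "ideal I R" "\<one> \<notin> I"
  obtains J where "maximalideal J R" "I \<subseteq> J"
proof -
  let ?A = "{J. ideal J R \<and> I \<subseteq> J \<and> \<one> \<notin> J}"
  have "\<exists>J\<in>?A. \<forall>X\<in>?A. J \<subseteq> X \<longrightarrow> X = J"
  proof (rule subset_Zorn_nonempty)
    show "?A \<noteq> {}" using assms by blast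
    fix C assume C: "C \<noteq> {}" "subset.chain ?A C"
    then have "subset.chain {J. ideal J R} C" by (auto simp: pred_on.chain_def)
    from chain_Union_is_ideal[OF this] C(1) have "ideal (\<Union>C) R" by simp
    with C show "\<Union>C \<in> ?A" unfolding pred_on.chain_def by blast
  qed
  then obtain J where J: "ideal J R" "I \<subseteq> J" "\<one> \<notin> J"
    and max: "\<And>X. ideal X R \<Longrightarrow> I \<subseteq> X \<Longrightarrow> \<one> \<notin> X \<Longrightarrow> J \<subseteq> X \<Longrightarrow> X = J"
    by auto
  have "maximalideal J R"
  proof (rule maximalidealI)
    fix X assume "ideal X R" "J \<subseteq> X" "X \<subseteq> carrier R"
    then show "X = J \<or> X = carrier R"
      using max[of X] J(2) ideal.one_imp_carrier[of X R] by blast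
  qed (use J in auto)
  with J(2) that show thesis by blast
qed

context Module.module
begin

lemma submodule_zero_closed:
  assumes "submodule N R M" shows "\<zero>\<^bsub>M\<^esub> \<in> N"
  using subgroup.one_closed[OF submodule.axioms(1)[OF assms]] by simp

text \<open>Used in two cases: \<open>Y = carrier M\<close> gives the colon ideal of
  \<open>N\<close>, and a singleton \<open>Y\<close> gives the ideal of scalars moving one element
  into \<open>N\<close>.\<close>

lemma ideal_residual:
  assumes N: "submodule N R M" and Y: "Y \<subseteq> carrier M"
  shows "ideal {r \<in> carrier R. \<forall>y\<in>Y. r \<odot>\<^bsub>M\<^esub> y \<in> N} R" (is "ideal ?J R")
proof (rule idealI)
  show "ring R" by (rule R.ring_axioms)
  show "subgroup ?J (add_monoid R)"
  proof (rule R.add.subgroupI)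
    show "?J \<noteq> {}"
      using submodule_zero_closed[OF N] Y smult_l_null by fastforce
  next
    fix a assume "a \<in> ?J"
    then show "\<ominus> a \<in> ?J" using Y submoduleE(3)[OF N] by (auto simp: smult_l_minus subset_iff)
  next
    fix a b assume "a \<in> ?J" "b \<in> ?J"
    then show "a \<oplus> b \<in> ?J" using Y submoduleE(5)[OF N] by (auto simp: smult_l_distr subset_iff)
  qed auto
  fix a x assume *: "a \<in> ?J" "x \<in> carrier R"
  then show "x \<otimes> a \<in> ?J"
    using Y submoduleE(4)[OF N] by (auto simp: smult_assoc1 subset_iff)
  with * show "a \<otimes> x \<in> ?J" by (auto simp: m_comm)
qed

lemma ideal_module_colon:
  assumes "submodule N R M" shows "ideal (module_colon R M N) R"
  using ideal_residual[OF assms order_refl] by (simp add: module_colon_def)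

text \<open>A proper ideal above \<open>I\<close> equals \<open>I\<close>. This applies to the colon
  ideal of \<open>N\<close> and also to the residual of any single \<open>x\<close> outside
  \<open>N\<close>, so every scalar moving such an \<open>x\<close> into \<open>N\<close> already
  lies in the colon ideal.\<close>

lemma prime_submodule_if_maximal_le_colon:
  assumes N: "submodule N R M" "N \<noteq> carrier M"
    and I: "maximalideal I R" "I \<subseteq> module_colon R M N"
  shows "prime_submodule R M N" "module_colon R M N = I"
proof -
  interpret I: maximalideal I R by fact
  have max: "J = I" if "ideal J R" "I \<subseteq> J" "\<one> \<notin> J" for J
    using I.I_maximal[OF that(1,2)] that(3) ideal.Icarr[OF that(1)] by blast
  have "\<one> \<notin> module_colon R M N"
    using N submoduleE(1)[OF N(1)] by (auto simp: module_colon_def)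
  with ideal_module_colon[OF N(1)] I(2) show colon: "module_colon R M N = I" by (rule max)
  have "r \<in> I" if "r \<in> carrier R" "x \<in> carrier M" "r \<odot>\<^bsub>M\<^esub> x \<in> N" "x \<notin> N" for r x
  proof -
    let ?J = "{r \<in> carrier R. \<forall>y\<in>{x}. r \<odot>\<^bsub>M\<^esub> y \<in> N}"
    have "?J = I"
    proof (rule max)
      show "ideal ?J R" using N(1) that(2) by (intro ideal_residual) auto
      show "I \<subseteq> ?J" using I(2) that(2) by (auto simp: module_colon_def)
      show "\<one> \<notin> ?J" using that by simp
    qed
    with that show ?thesis by blast
  qed
  with N colon show "prime_submodule R M N" by (auto simp: prime_submodule_def)
qed

section \<open>Spans with coefficients in an ideal, and the Nakayama argument\<close>

text \<open>Finite sums of products, built one summand at a time so that proofs can induct on them.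
  \<open>I = carrier R\<close> gives the usual span of \<open>X\<close>, and
  \<open>X = carrier M\<close> gives the submodule \<open>IM\<close>.\<close>

inductive_set ideal_span for I X where
  zero: "\<zero>\<^bsub>M\<^esub> \<in> ideal_span I X"
| add: "c \<in> I \<Longrightarrow> x \<in> X \<Longrightarrow> n \<in> ideal_span I X \<Longrightarrow> c \<odot>\<^bsub>M\<^esub> x \<oplus>\<^bsub>M\<^esub> n \<in> ideal_span I X"

lemma ideal_span_subset_carrier:
  assumes "I \<subseteq> carrier R" "X \<subseteq> carrier M"
  shows "ideal_span I X \<subseteq> carrier M"
proof
  fix n assume "n \<in> ideal_span I X"
  then show "n \<in> carrier M" by induction (use assms in auto)
qed

text \<open>The coefficient sets differ to serve two purposes: \<open>J = I\<close> gives closure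
  under scalars, while a scalar from an ideal carries the full span into the span over that
  ideal.\<close>

lemma smult_ideal_span:
  assumes "I \<subseteq> carrier R" "X \<subseteq> carrier M" "c \<in> carrier R"
    and "\<And>a. a \<in> I \<Longrightarrow> c \<otimes> a \<in> J"
    and "n \<in> ideal_span I X"
  shows "c \<odot>\<^bsub>M\<^esub> n \<in> ideal_span J X"
  using assms(5)
proof induction
  case zero
  then show ?case using assms(3) by (simp add: ideal_span.zero)
next
  case (add a x n)
  moreover have "n \<in> carrier M" using ideal_span_subset_carrier[OF assms(1,2)] add by blast
  moreover have "a \<in> carrier R" "x \<in> carrier M" using assms(1,2) add by auto
  ultimately show ?case
    using ideal_span.add[OF assms(4)[of a], of x X "c \<odot>\<^bsub>M\<^esub> n"] assms(3)
    by (simp add: smult_r_distr smult_assoc1)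
qed

lemma submodule_ideal_span:
  assumes I: "ideal I R" and X: "X \<subseteq> carrier M"
  shows "submodule (ideal_span I X) R M"
proof -
  interpret I: ideal I R by fact
  note sub = ideal_span_subset_carrier[OF I.a_subset X]
  have smult: "c \<odot>\<^bsub>M\<^esub> n \<in> ideal_span I X" if "c \<in> carrier R" "n \<in> ideal_span I X" for c n
    using smult_ideal_span[OF I.a_subset X that(1) _ that(2)] I.I_l_closed[OF _ that(1)] by blast
  show ?thesis
  proof (rule submoduleI)
    fix n assume n: "n \<in> ideal_span I X"
    then have "\<ominus>\<^bsub>M\<^esub> n = (\<ominus> \<one>) \<odot>\<^bsub>M\<^esub> n" using sub by (auto simp: smult_l_minus)
    with smult n show "\<ominus>\<^bsub>M\<^esub> n \<in> ideal_span I X" by simp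
  next
    fix m n assume "m \<in> ideal_span I X" and n: "n \<in> ideal_span I X"
    then show "m \<oplus>\<^bsub>M\<^esub> n \<in> ideal_span I X"
    proof induction
      case zero
      then show ?case using sub by auto
    next
      case (add a x m)
      then have "a \<odot>\<^bsub>M\<^esub> x \<oplus>\<^bsub>M\<^esub> m \<oplus>\<^bsub>M\<^esub> n = a \<odot>\<^bsub>M\<^esub> x \<oplus>\<^bsub>M\<^esub> (m \<oplus>\<^bsub>M\<^esub> n)"
        using sub X I.a_subset by (intro M.a_assoc) auto
      then show ?case using add ideal_span.add by simp
    qed
  qed (use sub smult ideal_span.zero in auto)
qed

lemma ideal_span_mono:
  assumes "I \<subseteq> J" shows "ideal_span I X \<subseteq> ideal_span J X"
proof
  fix n assume "n \<in> ideal_span I X"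
  then show "n \<in> ideal_span J X" by induction (use assms ideal_span.intros in auto)
qed

lemma smult_in_ideal_span:
  assumes "a \<in> I" "x \<in> X" "I \<subseteq> carrier R" "X \<subseteq> carrier M"
  shows "a \<odot>\<^bsub>M\<^esub> x \<in> ideal_span I X"
proof -
  have "a \<odot>\<^bsub>M\<^esub> x \<oplus>\<^bsub>M\<^esub> \<zero>\<^bsub>M\<^esub> \<in> ideal_span I X"
    using assms by (intro ideal_span.intros)
  with assms show ?thesis by (simp add: subset_iff)
qed

text \<open>All summands on \<open>y\<close> merge into one, since their coefficients add up inside
  \<open>I\<close>.\<close>

lemma ideal_span_insertE:
  assumes I: "ideal I R" and X: "insert y X \<subseteq> carrier M" and n: "n \<in> ideal_span I (insert y X)"
  obtains a n' where "a \<in> I" "n' \<in> ideal_span I X" "n = a \<odot>\<^bsub>M\<^esub> y \<oplus>\<^bsub>M\<^esub> n'"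
proof -
  interpret I: ideal I R by fact
  have y: "y \<in> carrier M" using X by simp
  note sub = ideal_span_subset_carrier[OF I.a_subset, of X]
  from n have "\<exists>a\<in>I. \<exists>n'\<in>ideal_span I X. n = a \<odot>\<^bsub>M\<^esub> y \<oplus>\<^bsub>M\<^esub> n'"
  proof induction
    case zero
    have "\<zero>\<^bsub>M\<^esub> = \<zero> \<odot>\<^bsub>M\<^esub> y \<oplus>\<^bsub>M\<^esub> \<zero>\<^bsub>M\<^esub>" using y by (simp add: smult_l_null)
    then show ?case using I.zero_closed ideal_span.zero by blast
  next
    case (add c x n)
    then obtain a n' where an: "a \<in> I" "n' \<in> ideal_span I X" "n = a \<odot>\<^bsub>M\<^esub> y \<oplus>\<^bsub>M\<^esub> n'"
      by blast
    have carr: "a \<in> carrier R" "c \<in> carrier R" "x \<in> carrier M" "n' \<in> carrier M"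
      using an add sub X I.a_subset by auto
    show ?case
    proof (cases "x = y")
      case True
      have "c \<odot>\<^bsub>M\<^esub> x \<oplus>\<^bsub>M\<^esub> n = (c \<oplus> a) \<odot>\<^bsub>M\<^esub> y \<oplus>\<^bsub>M\<^esub> n'"
        using carr y by (simp add: an True smult_l_distr M.a_assoc)
      then show ?thesis using an add.hyps(1) I.a_closed by blast
    next
      case False
      have "c \<odot>\<^bsub>M\<^esub> x \<oplus>\<^bsub>M\<^esub> n = a \<odot>\<^bsub>M\<^esub> y \<oplus>\<^bsub>M\<^esub> (c \<odot>\<^bsub>M\<^esub> x \<oplus>\<^bsub>M\<^esub> n')"
        using carr y by (simp add: an M.a_lcomm)
      moreover have "c \<odot>\<^bsub>M\<^esub> x \<oplus>\<^bsub>M\<^esub> n' \<in> ideal_span I X"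
        using False add.hyps an by (intro ideal_span.add) auto
      ultimately show ?thesis using an(1) by blast
    qed
  qed
  then show thesis using that by blast
qed

text \<open>
  Eliminates the generators one at a time: since \<open>M = IM\<close>, the assumption gives
  \<open>r y = a y + n\<close> with \<open>a \<in> I\<close> and \<open>n\<close> in the span of the remaining generators, so that
  \<open>r (r - a)\<close> multiplies \<open>M\<close> into that span.
\<close>
lemma annihilator_if_ideal_span_eq_carrier:
  assumes I: "primeideal I R" and IM: "carrier M \<subseteq> ideal_span I (carrier M)"
    and "finite X" "X \<subseteq> carrier M" "r \<in> carrier R" "r \<notin> I"
    and "\<And>m. m \<in> carrier M \<Longrightarrow> r \<odot>\<^bsub>M\<^esub> m \<in> ideal_span (carrier R) X"
  shows "\<exists>s\<in>carrier R - I. \<forall>m\<in>carrier M. s \<odot>\<^bsub>M\<^esub> m = \<zero>\<^bsub>M\<^esub>"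
  using assms(3-7)
proof (induction X arbitrary: r rule: finite_induct)
  case empty
  \<comment> \<open>With no generators left the span is zero, so \<open>r\<close> itself annihilates
    \<open>M\<close>.\<close>
  have "ideal_span (carrier R) {} \<subseteq> {\<zero>\<^bsub>M\<^esub>}"
    by (auto elim: ideal_span.cases)
  with empty show ?case by blast
next
  case (insert y X)
  interpret I: primeideal I R by fact
  note II = I.is_ideal
  have X: "X \<subseteq> carrier M" and y: "y \<in> carrier M" using insert.prems(1) by auto
  have span: "submodule (ideal_span (carrier R) X) R M"
    using submodule_ideal_span[OF R.oneideal X] .
  note span_carr = submoduleE(1)[OF span]
  \<comment> \<open>Since r (c x) = c (r x) and r x is in the full span, the factor \<open>c\<close>
    from \<open>I\<close> brings all coefficients into \<open>I\<close>.\<close>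
  have rIM: "r \<odot>\<^bsub>M\<^esub> z \<in> ideal_span I (insert y X)" if "z \<in> ideal_span I (carrier M)" for z
    using that
  proof induction
    case zero
    then show ?case using insert.prems by (simp add: ideal_span.zero)
  next
    case (add c x n)
    have carr: "c \<in> carrier R" "x \<in> carrier M" "n \<in> carrier M"
      using add ideal_span_subset_carrier[OF I.a_subset] by auto
    have "c \<odot>\<^bsub>M\<^esub> (r \<odot>\<^bsub>M\<^esub> x) \<in> ideal_span I (insert y X)"
      using carr add.hyps(1) insert.prems(1) I.I_r_closed
      by (intro smult_ideal_span[OF _ _ _ _ insert.prems(4)[OF carr(2)]]) auto
    moreover have "r \<odot>\<^bsub>M\<^esub> (c \<odot>\<^bsub>M\<^esub> x \<oplus>\<^bsub>M\<^esub> n) = c \<odot>\<^bsub>M\<^esub> (r \<odot>\<^bsub>M\<^esub> x) \<oplus>\<^bsub>M\<^esub> r \<odot>\<^bsub>M\<^esub> n"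
      using carr insert.prems(2) by (simp add: smult_r_distr m_comm flip: smult_assoc1)
    ultimately show ?case
      using add.IH submoduleE(5)[OF submodule_ideal_span[OF II insert.prems(1)]] by simp
  qed
  obtain a n where an: "a \<in> I" "n \<in> ideal_span I X" "r \<odot>\<^bsub>M\<^esub> y = a \<odot>\<^bsub>M\<^esub> y \<oplus>\<^bsub>M\<^esub> n"
    using ideal_span_insertE[OF II insert.prems(1) rIM[of y]] IM y by blast
  have a: "a \<in> carrier R" using an(1) I.a_subset by blast
  have n: "n \<in> ideal_span (carrier R) X" using an(2) ideal_span_mono[OF I.a_subset] by blast
  define t where "t = r \<ominus> a"
  have t: "t \<in> carrier R" using a insert.prems(2) by (simp add: t_def)
  have r_eq: "r = t \<oplus> a"
    using a insert.prems(2) by (simp add: t_def a_minus_def R.a_assoc R.l_neg)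
  have tI: "t \<notin> I" using insert.prems(3) an(1) I.a_closed by (auto simp: r_eq)
  \<comment> \<open>Cancelling the common summand a y leaves t y = n.\<close>
  have "a \<odot>\<^bsub>M\<^esub> y \<oplus>\<^bsub>M\<^esub> t \<odot>\<^bsub>M\<^esub> y = a \<odot>\<^bsub>M\<^esub> y \<oplus>\<^bsub>M\<^esub> n"
    using an(3) a t y by (simp add: r_eq smult_l_distr M.a_comm)
  then have ty: "t \<odot>\<^bsub>M\<^esub> y \<in> ideal_span (carrier R) X"
    using a t y n span_carr by (auto simp: subset_iff)
  show ?case
  proof (rule insert.IH[OF X])
    show "t \<otimes> r \<in> carrier R" using t insert.prems(2) by simp
    \<comment> \<open>Primality keeps the accumulated factor outside \<open>I\<close> throughout the
      induction.\<close>
    show "t \<otimes> r \<notin> I" using I.I_prime t tI insert.prems(2,3) by blast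
    fix m assume m: "m \<in> carrier M"
    obtain b n' where b: "b \<in> carrier R" "n' \<in> ideal_span (carrier R) X"
      "r \<odot>\<^bsub>M\<^esub> m = b \<odot>\<^bsub>M\<^esub> y \<oplus>\<^bsub>M\<^esub> n'"
      using ideal_span_insertE[OF R.oneideal insert.prems(1) insert.prems(4)[OF m]] .
    have "(t \<otimes> r) \<odot>\<^bsub>M\<^esub> m = b \<odot>\<^bsub>M\<^esub> (t \<odot>\<^bsub>M\<^esub> y) \<oplus>\<^bsub>M\<^esub> t \<odot>\<^bsub>M\<^esub> n'"
    proof -
      have "(t \<otimes> r) \<odot>\<^bsub>M\<^esub> m = t \<odot>\<^bsub>M\<^esub> (b \<odot>\<^bsub>M\<^esub> y) \<oplus>\<^bsub>M\<^esub> t \<odot>\<^bsub>M\<^esub> n'"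
        using t insert.prems(2) m b y span_carr by (auto simp: smult_assoc1 smult_r_distr)
      then show ?thesis using t b(1) y by (simp add: m_comm flip: smult_assoc1)
    qed
    then show "(t \<otimes> r) \<odot>\<^bsub>M\<^esub> m \<in> ideal_span (carrier R) X"
      using ty b t submoduleE(4,5)[OF span] by simp
  qed
qed

lemma carrier_subset_ideal_span:
  assumes "finite_generating_set R M X"
  shows "carrier M \<subseteq> ideal_span (carrier R) X"
proof
  have X: "finite X" "X \<subseteq> carrier M" using assms by (auto simp: finite_generating_set_def)
  note span = submodule_ideal_span[OF R.oneideal X(2)]
  fix m assume "m \<in> carrier M"
  then obtain c where c: "c \<in> X \<rightarrow> carrier R" and m: "m = (\<Oplus>\<^bsub>M\<^esub>x\<in>X. c x \<odot>\<^bsub>M\<^esub> x)"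
    using assms unfolding finite_generating_set_def by blast
  \<comment> \<open>The index set of the sum shrinks to \<open>Y\<close> for the induction, while
    the span over \<open>X\<close> stays fixed.\<close>
  have "(\<Oplus>\<^bsub>M\<^esub>x\<in>Y. c x \<odot>\<^bsub>M\<^esub> x) \<in> ideal_span (carrier R) X" if "finite Y" "Y \<subseteq> X" for Y
    using that
  proof (induction Y rule: finite_induct)
    case empty
    then show ?case by (simp add: ideal_span.zero)
  next
    case (insert y Y)
    have "(\<Oplus>\<^bsub>M\<^esub>x\<in>insert y Y. c x \<odot>\<^bsub>M\<^esub> x) = c y \<odot>\<^bsub>M\<^esub> y \<oplus>\<^bsub>M\<^esub> (\<Oplus>\<^bsub>M\<^esub>x\<in>Y. c x \<odot>\<^bsub>M\<^esub> x)"
      using insert c X(2) by (intro M.finsum_insert) (auto simp: Pi_def)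
    with insert c show ?case by (auto intro!: ideal_span.add)
  qed
  with X(1) m show "m \<in> ideal_span (carrier R) X" by blast
qed

lemma exists_prime_submodule_colon_eq_maximal:
  assumes fg: "fin_gen_module R M" and faithful: "faithful_module R M" and I: "maximalideal I R"
  shows "\<exists>P. prime_submodule R M P \<and> module_colon R M P = I"
proof -
  interpret I: maximalideal I R by fact
  let ?N = "ideal_span I (carrier M)"
  have N: "submodule ?N R M" using I.is_ideal by (rule submodule_ideal_span) simp
  have "?N \<noteq> carrier M"
  proof
    assume N_eq: "?N = carrier M"
    obtain X where X: "finite_generating_set R M X" using fg by (auto simp: fin_gen_module_def)
    then have fin: "finite X" "X \<subseteq> carrier M" by (auto simp: finite_generating_set_def)
    have "\<one> \<notin> I" using I.one_imp_carrier I.I_notcarr by blast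
    \<comment> \<open>The elimination starts from \<open>r = \<one>\<close>, because
      \<open>X\<close> generates \<open>M\<close>. Faithfulness then forces
      \<open>s = \<zero>\<close>, which lies in \<open>I\<close>.\<close>
    then have "\<exists>s\<in>carrier R - I. \<forall>m\<in>carrier M. s \<odot>\<^bsub>M\<^esub> m = \<zero>\<^bsub>M\<^esub>"
      using N_eq carrier_subset_ideal_span[OF X]
      by (intro annihilator_if_ideal_span_eq_carrier[OF maximalideal_prime[OF I] _ fin]) auto
    then show False using faithful I.zero_closed by (auto simp: faithful_module_def)
  qed
  moreover have "I \<subseteq> module_colon R M ?N"
    using smult_in_ideal_span[OF _ _ I.a_subset] I.a_subset by (auto simp: module_colon_def)
  ultimately show ?thesis using prime_submodule_if_maximal_le_colon[OF N _ I] by blast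
qed

section \<open>Open sets, the Lindelof property and failure of compactness\<close>

lemma openin_Spec_tilde_colon_subset:
  assumes I: "primeideal I R"
  shows "openin (Spec_tilde R M) {Q \<in> mod_Spec R M. module_colon R M Q \<subseteq> I}"
proof -
  interpret I: primeideal I R by fact
  have "submonoid (carrier R - I) R"
    using I.I_prime I.one_imp_carrier I.I_notcarr by (intro submonoid.intro) auto
  moreover have "module_colon R M Q \<subseteq> carrier R" for Q by (auto simp: module_colon_def)
  then have "{Q \<in> mod_Spec R M. module_colon R M Q \<subseteq> I} =
      mod_Spec R M - V_tilde R M {carrier R - I}"
    by (auto simp: V_tilde_def)
  ultimately show ?thesis
    unfolding openin_Spec_tilde[OF module_axioms] by (intro exI[of _ "{carrier R - I}"]) auto
qed

text \<open>Membership of \<open>P\<close> in \<open>U\<close> is witnessed by some multiplicatively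
  closed set disjoint from the colon ideal of \<open>P\<close>; it is then disjoint from the smaller
  one of \<open>Q\<close> too.\<close>

lemma openin_Spec_tilde_downward:
  assumes "openin (Spec_tilde R M) U" "P \<in> U" "Q \<in> mod_Spec R M"
    "module_colon R M Q \<subseteq> module_colon R M P"
  shows "Q \<in> U"
  using assms unfolding openin_Spec_tilde[OF module_axioms] V_tilde_def by blast

lemma colon_subset_maximalideal:
  assumes "P \<in> mod_Spec R M"
  obtains I where "maximalideal I R" "module_colon R M P \<subseteq> I"
proof -
  have P: "prime_submodule R M P" using assms by (simp add: mod_Spec_def)
  then have "ideal (module_colon R M P) R"
    by (intro ideal_module_colon) (simp add: prime_submodule_def)
  from R.exists_maximalideal_superset[OF this one_notin_module_colon[OF module_axioms P]] that
  show thesis by blast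
qed

lemma Lindelof_not_compact_Spec_tilde:
  assumes "countable {I. maximalideal I R}" "infinite {I. maximalideal I R}"
    and "fin_gen_module R M" "faithful_module R M"
  shows "Lindelof_space (Spec_tilde R M) \<and> \<not> compact_space (Spec_tilde R M)"
proof
  define Max where "Max = {I. maximalideal I R}"
  obtain F where F: "\<And>I. I \<in> Max \<Longrightarrow> F I \<in> mod_Spec R M \<and> module_colon R M (F I) = I"
    using exists_prime_submodule_colon_eq_maximal[OF assms(3,4)]
    unfolding Max_def mod_Spec_def by (metis mem_Collect_eq)
  note top = topspace_Spec_tilde[OF module_axioms]
  show "Lindelof_space (Spec_tilde R M)"
    unfolding Lindelof_space_alt top
  proof (intro allI impI, elim conjE)
    fix \<U> assume U: "\<forall>U\<in>\<U>. openin (Spec_tilde R M) U" "mod_Spec R M \<subseteq> \<Union>\<U>"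
    then have "\<forall>I\<in>Max. \<exists>U\<in>\<U>. F I \<in> U" using F by blast
    then obtain G where G: "\<And>I. I \<in> Max \<Longrightarrow> G I \<in> \<U> \<and> F I \<in> G I" by metis
    have "mod_Spec R M \<subseteq> \<Union>(G ` Max)"
    proof
      \<comment> \<open>The cover member chosen for \<open>F I\<close>, with \<open>I\<close> a
        maximal ideal above the colon ideal of \<open>P\<close>, contains \<open>P\<close> by
        downward closure.\<close>
      fix P assume P: "P \<in> mod_Spec R M"
      then obtain I where I: "I \<in> Max" "module_colon R M P \<subseteq> I"
        using colon_subset_maximalideal unfolding Max_def by blast
      moreover have "openin (Spec_tilde R M) (G I)" "F I \<in> G I" using G[OF I(1)] U(1) by blast+
      ultimately have "P \<in> G I"
        using F[OF I(1)] P by (simp add: openin_Spec_tilde_downward[of "G I" "F I"])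
      with I show "P \<in> \<Union>(G ` Max)" by blast
    qed
    moreover have "countable (G ` Max)" "G ` Max \<subseteq> \<U>"
      using assms(1) G by (auto simp: Max_def)
    ultimately show "\<exists>\<V>. countable \<V> \<and> \<V> \<subseteq> \<U> \<and> mod_Spec R M \<subseteq> \<Union>\<V>" by blast
  qed
  define H where "H I = {Q \<in> mod_Spec R M. module_colon R M Q \<subseteq> I}" for I
  show "\<not> compact_space (Spec_tilde R M)"
  proof
    assume "compact_space (Spec_tilde R M)"
    moreover have "\<forall>U\<in>H ` Max. openin (Spec_tilde R M) U"
      using openin_Spec_tilde_colon_subset R.maximalideal_prime by (auto simp: H_def Max_def)
    moreover have "mod_Spec R M \<subseteq> \<Union>(H ` Max)"
      using colon_subset_maximalideal unfolding Max_def H_def by blast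
    ultimately obtain \<F> where \<F>: "finite \<F>" "\<F> \<subseteq> H ` Max" "mod_Spec R M \<subseteq> \<Union>\<F>"
      unfolding compact_space_alt top by meson
    then obtain K where K: "K \<subseteq> Max" "finite K" "\<F> = H ` K"
      by (meson finite_subset_image)
    \<comment> \<open>\<open>F I\<close> lies in \<open>H J\<close> only if
      \<open>I \<subseteq> J\<close>, which forces \<open>I = J\<close> by maximality; hence every
      maximal ideal must index a member of the finite subcover.\<close>
    have "Max \<subseteq> K"
    proof
      fix I assume I: "I \<in> Max"
      with F \<F>(3) K(3) obtain J where J: "J \<in> K" "F I \<in> H J" by blast
      then have "I \<subseteq> J" using F[OF I] by (simp add: H_def)
      moreover have maxI: "maximalideal I R" and maxJ: "maximalideal J R"
        using I J(1) K(1) by (auto simp: Max_def)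
      moreover have "ideal J R" using maxJ by (rule maximalideal.axioms)
      ultimately have "J = I"
        using maximalideal.I_maximal[OF maxI, of J] maximalideal.I_notcarr[OF maxJ]
          ideal.Icarr[of J R] by blast
      with J show "I \<in> K" by simp
    qed
    with K(2) assms(2) show False unfolding Max_def using finite_subset by blast
  qed
qed

section \<open>Free modules of finite rank\<close>

text \<open>If \<open>r\<close> annihilates \<open>M\<close>, the constant coefficient function
  \<open>r\<close> is a vanishing combination of the basis, so independence at any basis element
  gives \<open>r = \<zero>\<close>.\<close>

lemma finite_basis_nonempty_imp_faithful:
  assumes B: "finite_basis R M B" "B \<noteq> {}"
  shows "faithful_module R M"
  unfolding faithful_module_def
proof (intro ballI impI)
  fix r assume r: "r \<in> carrier R" "\<forall>m\<in>carrier M. r \<odot>\<^bsub>M\<^esub> m = \<zero>\<^bsub>M\<^esub>"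
  have "B \<subseteq> carrier M" using B by (simp add: finite_basis_def finite_generating_set_def)
  with r have "(\<Oplus>\<^bsub>M\<^esub>x\<in>B. r \<odot>\<^bsub>M\<^esub> x) = (\<Oplus>\<^bsub>M\<^esub>x\<in>B. \<zero>\<^bsub>M\<^esub>)"
    by (intro M.finsum_cong') auto
  then have sum: "(\<Oplus>\<^bsub>M\<^esub>x\<in>B. r \<odot>\<^bsub>M\<^esub> x) = \<zero>\<^bsub>M\<^esub>" by simp
  have "\<forall>x\<in>B. r = \<zero>\<^bsub>R\<^esub>"
    using B(1) r(1) sum unfolding finite_basis_def by (auto dest!: bspec[of _ _ "\<lambda>_. r"])
  with B(2) show "r = \<zero>\<^bsub>R\<^esub>" by blast
qed

text \<open>Every submodule contains zero, so here none is proper.\<close>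

lemma mod_Spec_empty_if_trivial:
  assumes "carrier M \<subseteq> {\<zero>\<^bsub>M\<^esub>}"
  shows "mod_Spec R M = {}"
  using assms submodule_zero_closed submoduleE(1)
  unfolding mod_Spec_def prime_submodule_def by fastforce

text \<open>Nonemptiness of the spectrum excludes rank zero, where \<open>M\<close> would be the
  zero module.\<close>

lemma free_imp_faithful:
  assumes "free_module_fin_rank R M" "mod_Spec R M \<noteq> {}"
  shows "faithful_module R M"
proof -
  obtain B where B: "finite_basis R M B" using assms(1) by (auto simp: free_module_fin_rank_def)
  have "B \<noteq> {}"
  proof
    assume "B = {}"
    with B have "carrier M \<subseteq> {\<zero>\<^bsub>M\<^esub>}" by (auto simp: finite_basis_def finite_generating_set_def)
    with assms(2) mod_Spec_empty_if_trivial show False by blast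
  qed
  with B show ?thesis by (rule finite_basis_nonempty_imp_faithful)
qed

end

theorem corollary5:
  fixes R :: "('a, 'c) ring_scheme" and M :: "('a, 'b, 'd) module_scheme"
  assumes "Module.module R M"
    and "countable {I. maximalideal I R}" and "infinite {I. maximalideal I R}"
    and "mod_Spec R M \<noteq> {}"
  shows "(fin_gen_module R M \<and> faithful_module R M \<longrightarrow>
            Lindelof_space (Spec_tilde R M) \<and> \<not> compact_space (Spec_tilde R M)) \<and>
         (free_module_fin_rank R M \<longrightarrow>
            Lindelof_space (Spec_tilde R M) \<and> \<not> compact_space (Spec_tilde R M))"
proof -
  interpret Module.module R M by fact
  \<comment> \<open>A finite basis is a finite generating set, so the free case reduces to the
    finitely generated faithful one.\<close>
  have "fin_gen_module R M" if "free_module_fin_rank R M"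
    using that by (auto simp: free_module_fin_rank_def finite_basis_def fin_gen_module_def)
  then show ?thesis
    using Lindelof_not_compact_Spec_tilde[OF assms(2,3)] free_imp_faithful assms(4) by blast
qed

end
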